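(* Let $p\ge2$ be an integer, $a,b>0$, $x_0\in\mathbb{R}^p$, $q\in\{1,2,\infty\}$, and let $\mathcal{A}_q$, $\mathcal{B}$, the (general) minimax risk $R_p(n,\mathcal{A}_q,\mathcal{B})$ over all estimators and the CFD estimator $\bar L_n^p$ be as defined in the context. Then for every integer $n\ge1$, $$R_p(n,\mathcal{A}_q,\mathcal{B})\ge\frac1{16}e^{-2/3}\left(\frac{3ab\,p^{3/2}}{n}\right)^{2/3}\quad\text{for } q=1,$$ $$R_p(n,\mathcal{A}_q,\mathcal{B})\ge\frac1{16}e^{-2/3}\left(\frac{3ab}{n}\right)^{2/3}\quad\text{for } q=2,\infty.$$ Consequently, for $q=1,2,\infty$ the CFD estimator dividing the budget equally among all dimensions is optimal up to a multiplicative factor polynomial in $p$: there are absolute constants $C,k>0$ (independent of $n,p,a,b,x_0$) such that whenever $n$ is a multiple of $2p$, the estimator $\bar L_n^p$ with $\delta=\left(\frac{18b}{a^2}\right)^{1/6}(n/p)^{-1/6}$ satisfies $$\sup_{f\in\mathcal{A}_q,\ \sigma^2\in\mathcal{B}}E\|\bar L_n^p-\nabla f(x_0)\|_2^2\le C\,p^{k}\,R_p(n,\mathcal{A}_q,\mathcal{B}).$$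
   Context: Setting. $f:\mathbb{R}^p\to\mathbb{R}$ is an unknown function; at any chosen $x\in\mathbb{R}^p$ one can observe a random variable with mean $f(x)$ and variance $\sigma^2(x)$. The goal is to estimate $\nabla f(x_0)$. With budget $n\ge1$, one chooses deterministic design points $x_1,\dots,x_n\in\mathbb{R}^p$ (repetitions allowed) and observes independent outputs $Y_1,\dots,Y_n$, where $Y_j=Y_j(x_j)$ has mean $f(x_j)$ and variance $\sigma^2(x_j)$. An estimator is any measurable function $\widehat\theta=\widehat\theta(Y_1,\dots,Y_n)\in\mathbb{R}^p$ (no linearity is assumed). Problem classes, for given constants $a,b>0$: $\mathcal{A}_q$ is the set of functions $f:\mathbb{R}^p\to\mathbb{R}$ such that $\nabla^2f(x_0)$ exists and, for all $x\in\mathbb{R}^p$, $$\left|f(x)-f(x_0)-\nabla f(x_0)^T(x-x_0)-\tfrac12(x-x_0)^T\nabla^2f(x_0)(x-x_0)\right|\le\tfrac a6\|x-x_0\|_q^3,$$ with $\|\cdot\|_q$ the $\ell_q$-norm. $\mathcal{B}$ is the set of variance functions $\sigma^2:\mathbb{R}^p\to[0,\infty)$ with $\sigma^2(x)\le b$ for all $x$. Minimax risk: $$R_p(n,\mathcal{A}_q,\mathcal{B})=\inf_{x_1,\dots,x_n,\ \widehat\theta}\ \ \sup_{f\in\mathcal{A}_q,\ \sigma^2\in\mathcal{B}}E\|\widehat\theta-\nabla f(x_0)\|_2^2 ,$$ where the supremum is understood to range also over all laws of the independent outputs compatible with $f$ and $\sigma^2$ (means $f(x_j)$, variances $\sigma^2(x_j)$);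 in particular Gaussian noise is included. CFD estimator ($n$ a multiple of $2p$, $\delta>0$): the budget is split into $n/p$ independent evaluations for each coordinate $i=1,\dots,p$, and $\bar L_n^p=[(\bar L_n^p)_i]_{i=1,\dots,p}$ where $$(\bar L_n^p)_i=\frac{1}{n/(2p)}\sum_{j=1}^{n/(2p)}\frac{Y_{2j-1}(x_0+\delta e_i)-Y_{2j}(x_0-\delta e_i)}{2\delta},$$ with $e_i$ the $i$th standard basis vector (the evaluations used for different $i$ are distinct independent ones, for a total of $n$). *)

theory Defs
  imports "HOL-Probability.Probability"
begin

text \<open>
  The dimension \<open>p\<close> is a natural number (constants have to be uniform in it), so \<open>\<real>\<^sup>p\<close> is
  represented by the functions on \<open>{..<p}\<close> that are \<open>undefined\<close> elsewhere. This is the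
  underlying space of \<open>\<Pi>\<^sub>M i\<in>{..<p}. borel\<close>. Functions on \<open>\<real>\<^sup>p\<close> are total in HOL;
  their values outside \<open>Rn p\<close> are never used. Coordinates and observations are numbered from 0.
\<close>

definition Rn :: "nat \<Rightarrow> (nat \<Rightarrow> real) set" where
  "Rn p = ({..<p} \<rightarrow>\<^sub>E UNIV)"

text \<open>Meant for \<open>p \<ge> 1\<close> and \<open>q \<ge> 1\<close>.\<close>

definition lq_norm :: "enat \<Rightarrow> nat \<Rightarrow> (nat \<Rightarrow> real) \<Rightarrow> real" where
  "lq_norm q p v =
     (case q of enat m \<Rightarrow> root m (\<Sum>i<p. \<bar>v i\<bar> ^ m) | \<infinity> \<Rightarrow> Max ((\<lambda>i. \<bar>v i\<bar>) ` {..<p}))"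

definition has_partial :: "((nat \<Rightarrow> real) \<Rightarrow> real) \<Rightarrow> nat \<Rightarrow> (nat \<Rightarrow> real) \<Rightarrow> bool" where
  "has_partial f i x \<longleftrightarrow> (\<lambda>t. f (x(i := t))) differentiable (at (x i))"

definition partial :: "((nat \<Rightarrow> real) \<Rightarrow> real) \<Rightarrow> nat \<Rightarrow> (nat \<Rightarrow> real) \<Rightarrow> real" where
  "partial f i x = deriv (\<lambda>t. f (x(i := t))) (x i)"

text \<open>
  The gradient is the vector of first partial derivatives and the Hessian the matrix of second
  partial derivatives. For the Hessian to exist at \<open>x\<close>, each \<open>\<partial>\<^sub>j f\<close> has to exist near \<open>x\<close> on
  the line through \<open>x\<close> in every coordinate direction \<open>i\<close>, and to be differentiable at \<open>x\<close> along
  that line.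
\<close>

definition grad :: "((nat \<Rightarrow> real) \<Rightarrow> real) \<Rightarrow> (nat \<Rightarrow> real) \<Rightarrow> nat \<Rightarrow> real" where
  "grad f x i = partial f i x"

definition hessian :: "((nat \<Rightarrow> real) \<Rightarrow> real) \<Rightarrow> (nat \<Rightarrow> real) \<Rightarrow> nat \<Rightarrow> nat \<Rightarrow> real" where
  "hessian f x i j = partial (partial f j) i x"

definition hessian_exists :: "nat \<Rightarrow> ((nat \<Rightarrow> real) \<Rightarrow> real) \<Rightarrow> (nat \<Rightarrow> real) \<Rightarrow> bool" where
  "hessian_exists p f x \<longleftrightarrow>
     (\<forall>i<p. \<forall>j<p. (\<forall>\<^sub>F t in nhds (x i). has_partial f j (x(i := t))) \<and>
        has_partial (partial f j) i x)"

definition mean_class :: "enat \<Rightarrow> nat \<Rightarrow> real \<Rightarrow> (nat \<Rightarrow> real) \<Rightarrow> ((nat \<Rightarrow> real) \<Rightarrow> real) set" where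
  "mean_class q p a x0 =
     {f. hessian_exists p f x0 \<and>
        (\<forall>x\<in>Rn p.
           \<bar>f x - f x0 - (\<Sum>i<p. grad f x0 i * (x i - x0 i))
             - 1/2 * (\<Sum>i<p. \<Sum>j<p. (x i - x0 i) * hessian f x0 i j * (x j - x0 j))\<bar>
           \<le> a / 6 * lq_norm q p (\<lambda>i. x i - x0 i) ^ 3)}"

definition var_class :: "nat \<Rightarrow> real \<Rightarrow> ((nat \<Rightarrow> real) \<Rightarrow> real) set" where
  "var_class p b = {v. \<forall>x\<in>Rn p. 0 \<le> v x \<and> v x \<le> b}"

text \<open>
  Families of marginal laws of \<open>n\<close> outputs with means \<open>m j\<close> and variances \<open>s j\<close>. Since the
  outputs are independent, their joint law is the product of the marginals.
\<close>

definition output_laws :: "nat \<Rightarrow> (nat \<Rightarrow> real) \<Rightarrow> (nat \<Rightarrow> real) \<Rightarrow> (nat \<Rightarrow> real measure) set" where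
  "output_laws n m s =
     {M. \<forall>j<n. prob_space (M j) \<and> sets (M j) = sets borel \<and> integrable (M j) (\<lambda>y. y\<^sup>2) \<and>
        prob_space.expectation (M j) (\<lambda>y. y) = m j \<and> prob_space.variance (M j) (\<lambda>y. y) = s j}"

definition designs :: "nat \<Rightarrow> nat \<Rightarrow> (nat \<Rightarrow> nat \<Rightarrow> real) set" where
  "designs n p = {..<n} \<rightarrow> Rn p"

definition estimators :: "nat \<Rightarrow> nat \<Rightarrow> ((nat \<Rightarrow> real) \<Rightarrow> nat \<Rightarrow> real) set" where
  "estimators n p =
     measurable (Pi\<^sub>M {..<n} (\<lambda>_. borel :: real measure)) (Pi\<^sub>M {..<p} (\<lambda>_. borel :: real measure))"

text \<open>Risks are extended nonnegative reals, as an estimator may have infinite mean squared error.\<close>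

definition worst_case_risk ::
  "enat \<Rightarrow> nat \<Rightarrow> nat \<Rightarrow> real \<Rightarrow> real \<Rightarrow> (nat \<Rightarrow> real) \<Rightarrow> (nat \<Rightarrow> nat \<Rightarrow> real)
     \<Rightarrow> ((nat \<Rightarrow> real) \<Rightarrow> nat \<Rightarrow> real) \<Rightarrow> ennreal" where
  "worst_case_risk q p n a b x0 X est =
     (\<Squnion>f\<in>mean_class q p a x0. \<Squnion>v\<in>var_class p b.
        \<Squnion>M\<in>output_laws n (\<lambda>j. f (X j)) (\<lambda>j. v (X j)).
          \<integral>\<^sup>+ y. ennreal (\<Sum>i<p. (est y i - grad f x0 i)\<^sup>2) \<partial>Pi\<^sub>M {..<n} M)"

definition minimax_risk ::
  "enat \<Rightarrow> nat \<Rightarrow> nat \<Rightarrow> real \<Rightarrow> real \<Rightarrow> (nat \<Rightarrow> real) \<Rightarrow> ennreal" where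
  "minimax_risk q p n a b x0 =
     (\<Sqinter>X\<in>designs n p. \<Sqinter>est\<in>estimators n p. worst_case_risk q p n a b x0 X est)"

text \<open>
  Central finite differences, for \<open>n\<close> a multiple of \<open>2 * p\<close>. The observations are arranged in
  \<open>p\<close> consecutive blocks of length \<open>n div p\<close>, one for each coordinate \<open>i\<close>; inside a block,
  the evaluations at \<open>x0 + \<delta> e\<^sub>i\<close> and at \<open>x0 - \<delta> e\<^sub>i\<close> alternate, starting with the former.
\<close>

definition cfd_design :: "nat \<Rightarrow> nat \<Rightarrow> (nat \<Rightarrow> real) \<Rightarrow> real \<Rightarrow> nat \<Rightarrow> nat \<Rightarrow> real" where
  "cfd_design p n x0 \<delta> k =
     (let i = k div (n div p); l = k mod (n div p)
      in x0(i := x0 i + (if even l then \<delta> else - \<delta>)))"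

definition cfd_estimator :: "nat \<Rightarrow> nat \<Rightarrow> real \<Rightarrow> (nat \<Rightarrow> real) \<Rightarrow> nat \<Rightarrow> real" where
  "cfd_estimator p n \<delta> y =
     (\<lambda>i\<in>{..<p}. 1 / (real n / (2 * real p)) *
        (\<Sum>j<n div (2 * p).
           (y (i * (n div p) + 2 * j) - y (i * (n div p) + 2 * j + 1)) / (2 * \<delta>)))"

end

(*
  Lower bound: for a vector w with |<w, v>| <= |v|_q, the ridge functions
  f(x) = A sin(theta <w, x - x0> / A) and -f have gradients theta w and -theta w at x0, and
  |sin z - z| <= |z|^3 / 6 puts both into A_q once theta^3 = a A^2. They are bounded by A, which is
  at most sqrt b, so the outputs may be taken in {sqrt b, - sqrt b}. The product of the two
  likelihood ratios with respect to uniform signs is then constant, and for A^2 = 3b/(8n) it is at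
  least 5/8; hence every estimator has risk at least (5/8) theta^2 |w|_2^2 under f or under -f.
  The choice w = (1,...,1) for q = 1 gives the factor p, and w = e_0 serves q = 2 and q = infinity.

  Upper bound: the even terms of the Taylor expansion cancel in a central difference, so each
  coordinate has bias at most a delta^2 / 6 and variance at most b p / (n delta^2).
*)

theory Submission
  imports Defs
begin

section \<open>Sine ridge functions as members of the mean class\<close>

lemma abs_sin_minus_self_le: "\<bar>sin x - x\<bar> \<le> \<bar>x\<bar> ^ 3 / (6::real)"
proof -
  \<comment> \<open>The sine series has no quadratic term, so its polynomial of degree below 3 is
    just \<open>x\<close> and the remainder of order 3 bounds the distance to it.\<close>
  have "(\<Sum>m<3. sin_coeff m * x ^ m) = x"
    by (simp add: eval_nat_numeral sin_coeff_def)
  with Maclaurin_sin_bound[of x 3] show ?thesis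
    by (simp add: fact_numeral divide_simps)
qed

lemma inner_fun_upd:
  fixes w :: "nat \<Rightarrow> real"
  assumes "j < p"
  shows "(\<Sum>i<p. w i * ((x(j := t)) i - x0 i)) = (\<Sum>i<p. w i * (x i - x0 i)) + w j * (t - x j)"
proof -
  have "(\<Sum>i<p. w i * ((x(j := t)) i - x0 i)) =
        (\<Sum>i<p. w i * (x i - x0 i) + (if i = j then w j * (t - x j) else 0))"
    by (rule sum.cong) (auto simp: algebra_simps)
  then show ?thesis
    using assms by (simp add: sum.distrib)
qed

text \<open>Amplitude and slope are separate parameters: \<open>A\<close> bounds the values, while
  \<open>\<theta>\<close> scales the gradient at \<open>x0\<close>. Reversing the sign of
  \<open>\<theta>\<close> gives the opposite function, so facts about one family serve both
  hypotheses.\<close>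

definition sin_ridge :: "nat \<Rightarrow> (nat \<Rightarrow> real) \<Rightarrow> (nat \<Rightarrow> real) \<Rightarrow> real \<Rightarrow> real \<Rightarrow> (nat \<Rightarrow> real) \<Rightarrow> real" where
  "sin_ridge p w x0 A \<theta> x = A * sin (\<theta> / A * (\<Sum>i<p. w i * (x i - x0 i)))"

lemma sin_ridge_has_derivative:
  assumes "j < p" "A \<noteq> 0"
  shows "((\<lambda>t. sin_ridge p w x0 A \<theta> (x(j := t))) has_real_derivative
            \<theta> * w j * cos (\<theta> / A * (\<Sum>i<p. w i * (x i - x0 i)))) (at (x j))"
  unfolding sin_ridge_def inner_fun_upd[OF assms(1)]
  using assms(2) by (auto intro!: derivative_eq_intros)

lemma has_partial_sin_ridge:
  assumes "j < p" "A \<noteq> 0"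
  shows "has_partial (sin_ridge p w x0 A \<theta>) j x"
  unfolding has_partial_def real_differentiable_def
 
  using sin_ridge_has_derivative[OF assms] by blast

lemma partial_sin_ridge:
  assumes "j < p" "A \<noteq> 0"
  shows "partial (sin_ridge p w x0 A \<theta>) j = (\<lambda>x. \<theta> * w j * cos (\<theta> / A * (\<Sum>i<p. w i * (x i - x0 i))))"
  unfolding partial_def using sin_ridge_has_derivative[OF assms] by (intro ext DERIV_imp_deriv)

lemma grad_sin_ridge:
  assumes "i < p" "A \<noteq> 0"
  shows "grad (sin_ridge p w x0 A \<theta>) x0 i = \<theta> * w i"
  by (simp add: grad_def partial_sin_ridge[OF assms])

text \<open>The ridge argument vanishes at \<open>x0\<close> and the cosine is stationary at 0.
  Hence the Hessian at \<open>x0\<close> is zero and the second-order remainder in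
  \<open>mean_class\<close> reduces to the first-order one.\<close>

lemma partial_sin_ridge_has_derivative:
  assumes "i < p" "j < p" "A \<noteq> 0"
  shows "((\<lambda>t. partial (sin_ridge p w x0 A \<theta>) j (x0(i := t))) has_real_derivative 0) (at (x0 i))"
  unfolding partial_sin_ridge[OF assms(2,3)] inner_fun_upd[OF assms(1)]
  using assms(3) by (auto intro!: derivative_eq_intros)

text \<open>The sine remainder along the ridge is
  \<open>\<bar>\<theta>\<bar> ^ 3 / A\<^sup>2 * \<bar>z\<bar> ^ 3 / 6\<close>. Hypothesis
  \<open>scale\<close> turns its coefficient into \<open>a / 6\<close>, and hypothesis
  \<open>w\<close>, which bounds the dual norm of \<open>w\<close> by 1, replaces
  \<open>\<bar>z\<bar>\<close> by the norm of the displacement.\<close>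

lemma sin_ridge_in_mean_class:
  assumes A: "A \<noteq> 0" and scale: "\<bar>\<theta>\<bar> ^ 3 = a * A\<^sup>2"
    and w: "\<And>v. \<bar>\<Sum>i<p. w i * v i\<bar> \<le> lq_norm q p v"
  shows "sin_ridge p w x0 A \<theta> \<in> mean_class q p a x0"
proof -
  let ?f = "sin_ridge p w x0 A \<theta>"
  have hess: "hessian ?f x0 i j = 0" if "i < p" "j < p" for i j
    unfolding hessian_def partial_def[of _ i]
    using partial_sin_ridge_has_derivative[OF that A] by (rule DERIV_imp_deriv)
  have "has_partial (partial ?f j) i x0" if "i < p" "j < p" for i j
    unfolding has_partial_def real_differentiable_def
    using partial_sin_ridge_has_derivative[OF that A] by blast
  then have hess_ex: "hessian_exists p ?f x0"
    by (simp add: hessian_exists_def has_partial_sin_ridge A)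
  have "a \<ge> 0"
    using scale A by (metis abs_ge_zero zero_le_mult_iff zero_le_power power2_less_0 linorder_not_le
        zero_less_power2)
  have "\<bar>?f x - ?f x0 - (\<Sum>i<p. grad ?f x0 i * (x i - x0 i))
         - 1/2 * (\<Sum>i<p. \<Sum>j<p. (x i - x0 i) * hessian ?f x0 i j * (x j - x0 j))\<bar>
           \<le> a / 6 * lq_norm q p (\<lambda>i. x i - x0 i) ^ 3" for x
  proof -
    define z where "z = (\<Sum>i<p. w i * (x i - x0 i))"
    have lin: "(\<Sum>i<p. grad ?f x0 i * (x i - x0 i)) = \<theta> * z"
      by (simp add: grad_sin_ridge A z_def sum_distrib_left mult.assoc)
    have "\<bar>?f x - ?f x0 - \<theta> * z\<bar> = \<bar>A * (sin (\<theta> / A * z) - \<theta> / A * z)\<bar>"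
      using A by (simp add: sin_ridge_def z_def algebra_simps)
    also have "\<dots> \<le> \<bar>A\<bar> * (\<bar>\<theta> / A * z\<bar> ^ 3 / 6)"
      unfolding abs_mult[of A] by (intro mult_left_mono abs_sin_minus_self_le) simp
    also have "\<dots> = \<bar>\<theta>\<bar> ^ 3 / A\<^sup>2 * \<bar>z\<bar> ^ 3 / 6"
      using A by (simp add: abs_mult abs_divide power_mult_distrib power_divide field_simps
          power2_eq_square power3_eq_cube flip: abs_mult)
    also have "\<dots> = a / 6 * \<bar>z\<bar> ^ 3"
      using A by (simp add: scale)
    also have "\<dots> \<le> a / 6 * lq_norm q p (\<lambda>i. x i - x0 i) ^ 3"
      using w[of "\<lambda>i. x i - x0 i"] \<open>a \<ge> 0\<close> by (intro mult_left_mono power_mono) (auto simp: z_def)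
    finally show ?thesis
      by (simp add: lin hess)
  qed
  with hess_ex show ?thesis
    unfolding mean_class_def by blast
qed

section \<open>The three norms on coordinate directions\<close>

lemma abs_coord_le_lq_norm:
  assumes "q \<in> {2, \<infinity>}" "0 < p"
  shows "\<bar>v 0\<bar> \<le> lq_norm q p v"
proof (cases "q = \<infinity>")
  case True
  then show ?thesis
    using assms by (auto simp: lq_norm_def intro!: Max_ge)
next
  case False
  have "\<bar>v 0\<bar> = sqrt (\<bar>v 0\<bar>\<^sup>2)"
    by simp
  also have "\<dots> \<le> sqrt (\<Sum>i<p. \<bar>v i\<bar>\<^sup>2)"
    using assms(2) by (intro real_sqrt_le_mono member_le_sum[of 0 "{..<p}" "\<lambda>i. \<bar>v i\<bar>\<^sup>2"]) auto
  also have "\<dots> = lq_norm q p v"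
    using False assms(1) by (auto simp: lq_norm_def numeral_eq_enat sqrt_def)
  finally show ?thesis .
qed

lemma lq_norm_1: "lq_norm 1 p v = (\<Sum>i<p. \<bar>v i\<bar>)"
  by (simp add: lq_norm_def one_enat_def)

text \<open>Central differences move along coordinate axes only, where the three norms agree; this
  makes the upper bound the same for every \<open>q\<close>.\<close>

lemma lq_norm_single:
  assumes "q \<in> {1, 2, \<infinity>}" "i < p"
  shows "lq_norm q p (\<lambda>j. (x0(i := x0 i + s)) j - x0 j) = \<bar>s\<bar>"
proof -
  have *: "(\<lambda>j. (x0(i := x0 i + s)) j - x0 j) = (\<lambda>j. if j = i then s else 0)"
    by auto
  have pow: "\<bar>if j = i then s else 0\<bar> ^ m = (if j = i then \<bar>s\<bar> ^ m else 0)" if "m > 0" for j m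
    using that by auto
  have "Max ((\<lambda>j. \<bar>if j = i then s else 0\<bar>) ` {..<p}) = \<bar>s\<bar>"
    using assms(2) by (intro Max_eqI) (auto split: if_splits intro!: image_eqI[of _ _ i])
  moreover have "(\<Sum>j<p. \<bar>if j = i then s else 0\<bar> ^ m) = \<bar>s\<bar> ^ m" if "m > 0" for m
    using assms(2) by (simp add: pow[OF that])
  from this[of 1] this[of 2] have "(\<Sum>j<p. \<bar>if j = i then s else 0\<bar>) = \<bar>s\<bar>"
    "(\<Sum>j<p. \<bar>if j = i then s else 0\<bar>\<^sup>2) = \<bar>s\<bar>\<^sup>2"
    by simp_all
  ultimately show ?thesis
    using assms unfolding *
    by (auto simp: lq_norm_def one_enat_def numeral_eq_enat sqrt_def[symmetric] simp del: power2_abs)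
qed

section \<open>Product measures: densities and second moments\<close>

text \<open>It suffices to compare the measures on boxes. There the indicator factorizes like the
  density, so the integral splits into the marginal masses.\<close>

lemma PiM_density:
  assumes "finite I" and M: "\<And>i. prob_space (M i)"
    and h [measurable]: "\<And>i. h i \<in> borel_measurable (M i)"
    and dens: "\<And>i. prob_space (density (M i) (h i))"
  shows "Pi\<^sub>M I (\<lambda>i. density (M i) (h i)) = density (Pi\<^sub>M I M) (\<lambda>y. \<Prod>i\<in>I. h i (y i))"
proof -
  interpret M: product_sigma_finite M
    using M by (simp add: product_sigma_finite_def prob_space_imp_sigma_finite)
  interpret D: product_sigma_finite "\<lambda>i. density (M i) (h i)"
    using dens by (simp add: product_sigma_finite_def prob_space_imp_sigma_finite)
  have sets_eq: "sets (Pi\<^sub>M I M) = sets (Pi\<^sub>M I (\<lambda>i. density (M i) (h i)))"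
    by (intro sets_PiM_cong) auto
  show ?thesis
  proof (rule D.PiM_eqI[symmetric])
    fix A assume "\<And>i. i \<in> I \<Longrightarrow> A i \<in> sets (density (M i) (h i))"
    then have A [measurable]: "\<And>i. i \<in> I \<Longrightarrow> A i \<in> sets (M i)"
      by simp
    then have PA: "Pi\<^sub>E I A \<in> sets (Pi\<^sub>M I M)"
      using \<open>finite I\<close> by (intro sets_PiM_I_finite) auto
    have "emeasure (density (Pi\<^sub>M I M) (\<lambda>y. \<Prod>i\<in>I. h i (y i))) (Pi\<^sub>E I A) =
          (\<integral>\<^sup>+ y. (\<Prod>i\<in>I. h i (y i)) * indicator (Pi\<^sub>E I A) y \<partial>Pi\<^sub>M I M)"
      using PA \<open>finite I\<close> by (intro emeasure_density) auto
    also have "\<dots> = (\<integral>\<^sup>+ y. (\<Prod>i\<in>I. h i (y i) * indicator (A i) (y i)) \<partial>Pi\<^sub>M I M)"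
    proof (rule nn_integral_cong)
      fix y assume y: "y \<in> space (Pi\<^sub>M I M)"
      show "(\<Prod>i\<in>I. h i (y i)) * indicator (Pi\<^sub>E I A) y = (\<Prod>i\<in>I. h i (y i) * indicator (A i) (y i))"
        using y \<open>finite I\<close>
        by (cases "\<exists>i\<in>I. y i \<notin> A i")
           (auto simp: space_PiM PiE_iff indicator_def intro!: prod.cong)
    qed
    also have "\<dots> = (\<Prod>i\<in>I. \<integral>\<^sup>+ y. h i y * indicator (A i) y \<partial>M i)"
      using \<open>finite I\<close> by (intro M.product_nn_integral_prod) auto
    also have "\<dots> = (\<Prod>i\<in>I. emeasure (density (M i) (h i)) (A i))"
      by (intro prod.cong refl emeasure_density[symmetric]) auto
    finally show "emeasure (density (Pi\<^sub>M I M) (\<lambda>y. \<Prod>i\<in>I. h i (y i))) (Pi\<^sub>E I A) =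
        (\<Prod>i\<in>I. emeasure (density (M i) (h i)) (A i))" .
  qed (use \<open>finite I\<close> sets_eq in auto)
qed

text \<open>Bias-variance decomposition for a linear statistic of independent outputs, by induction
  on the index set. For fixed other coordinates the rest of the sum is a constant \<open>r\<close>,
  and integrating out the new coordinate adds only its variance term.\<close>

lemma nn_integral_PiM_affine_square:
  fixes c m s :: "'i \<Rightarrow> real" and \<beta> :: real
  assumes "finite I" and M: "\<And>i. prob_space (M i)"
    and sets: "\<And>i. i \<in> I \<Longrightarrow> sets (M i) = sets borel"
    and sq: "\<And>i. i \<in> I \<Longrightarrow> integrable (M i) (\<lambda>y. y\<^sup>2)"
    and mean: "\<And>i. i \<in> I \<Longrightarrow> prob_space.expectation (M i) (\<lambda>y. y) = m i"
    and var: "\<And>i. i \<in> I \<Longrightarrow> prob_space.variance (M i) (\<lambda>y. y) = s i"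
  shows "(\<integral>\<^sup>+ y. ennreal ((\<beta> + (\<Sum>i\<in>I. c i * (y i - m i)))\<^sup>2) \<partial>Pi\<^sub>M I M) =
           ennreal (\<beta>\<^sup>2 + (\<Sum>i\<in>I. (c i)\<^sup>2 * s i))"
  using assms(1) sets sq mean var
proof (induction I)
  case empty
  interpret product_sigma_finite M
    using M by (simp add: product_sigma_finite_def prob_space_imp_sigma_finite)
  show ?case
    by (subst nn_integral_empty) simp_all
next
  case (insert k I)
  interpret product_sigma_finite M
    using M by (simp add: product_sigma_finite_def prob_space_imp_sigma_finite)
  interpret Mk: prob_space "M k"
    by (rule M)
  note [measurable_cong] = insert.prems(1)
  note IH = insert.IH[OF insert.prems(1-4)[OF insertI2], simplified]
  have [measurable]: "(\<lambda>y. y i) \<in> borel_measurable (Pi\<^sub>M (insert k I) M)" if "i \<in> insert k I" for i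
    using measurable_component_singleton[OF that, of M] insert.prems(1)[OF that]
    by (simp cong: measurable_cong_sets)
  have id [measurable]: "(\<lambda>y. y) \<in> borel_measurable (M k)"
    using insert.prems(1)[of k] by (simp cong: measurable_cong_sets)
  have int: "integrable (M k) (\<lambda>y. y)"
    using insert.prems(2)[of k] by (intro Mk.square_integrable_imp_integrable[OF id]) auto
  have s_nonneg: "0 \<le> s i" if "i \<in> insert k I" for i
    unfolding insert.prems(4)[OF that, symmetric] by (rule Bochner_Integration.integral_nonneg) simp
  have inner: "(\<integral>\<^sup>+ y. ennreal ((r + c k * (y - m k))\<^sup>2) \<partial>M k) = ennreal (r\<^sup>2 + (c k)\<^sup>2 * s k)" for r
  proof -
    have ints: "integrable (M k) (\<lambda>y. (y - m k)\<^sup>2)"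
      using insert.prems(2)[of k] int by (simp add: power2_diff)
    \<comment> \<open>The last summand is centred and integrates to zero, so the contribution of
      coordinate \<open>k\<close> does not depend on \<open>r\<close>.\<close>
    have eq: "(r + c k * (y - m k))\<^sup>2 = r\<^sup>2 + (c k)\<^sup>2 * (y - m k)\<^sup>2 + 2 * r * c k * (y - m k)" for y
      by (simp add: power2_eq_square algebra_simps)
    have "(\<integral>y. (r + c k * (y - m k))\<^sup>2 \<partial>M k) = r\<^sup>2 + (c k)\<^sup>2 * s k"
      unfolding eq using ints int insert.prems(3,4)[of k]
      by (simp add: Mk.prob_space)
    moreover have "integrable (M k) (\<lambda>y. (r + c k * (y - m k))\<^sup>2)"
      unfolding eq using ints int by simp
    ultimately show ?thesis
      by (simp add: nn_integral_eq_integral)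
  qed
  have "(\<integral>\<^sup>+ y. ennreal ((\<beta> + (\<Sum>i\<in>insert k I. c i * (y i - m i)))\<^sup>2) \<partial>Pi\<^sub>M (insert k I) M) =
      (\<integral>\<^sup>+ x. \<integral>\<^sup>+ y. ennreal ((\<beta> + (\<Sum>i\<in>insert k I. c i * ((x(k := y)) i - m i)))\<^sup>2) \<partial>M k \<partial>Pi\<^sub>M I M)"
    using insert.hyps by (intro product_nn_integral_insert) measurable
  also have "\<dots> = (\<integral>\<^sup>+ x. \<integral>\<^sup>+ y. ennreal (((\<beta> + (\<Sum>i\<in>I. c i * (x i - m i))) + c k * (y - m k))\<^sup>2) \<partial>M k \<partial>Pi\<^sub>M I M)"
  proof (intro nn_integral_cong arg_cong[where f = "\<lambda>x. ennreal (x\<^sup>2)"])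
    fix x y
    have "(\<Sum>i\<in>I. c i * ((x(k := y)) i - m i)) = (\<Sum>i\<in>I. c i * (x i - m i))"
      using insert.hyps(2) by (intro sum.cong) auto
    then show "\<beta> + (\<Sum>i\<in>insert k I. c i * ((x(k := y)) i - m i)) =
        \<beta> + (\<Sum>i\<in>I. c i * (x i - m i)) + c k * (y - m k)"
      using insert.hyps by simp
  qed
  also have "\<dots> = (\<integral>\<^sup>+ x. ennreal ((\<beta> + (\<Sum>i\<in>I. c i * (x i - m i)))\<^sup>2) + ennreal ((c k)\<^sup>2 * s k) \<partial>Pi\<^sub>M I M)"
    unfolding inner using s_nonneg[of k] by (intro nn_integral_cong) (simp add: ennreal_plus)
  also have "\<dots> = (\<integral>\<^sup>+ x. ennreal ((\<beta> + (\<Sum>i\<in>I. c i * (x i - m i)))\<^sup>2) \<partial>Pi\<^sub>M I M) + ennreal ((c k)\<^sup>2 * s k)"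
  proof (subst nn_integral_add)
    have [measurable]: "(\<lambda>y. y i) \<in> borel_measurable (Pi\<^sub>M I M)" if "i \<in> I" for i
      using measurable_component_singleton[OF that, of M] insert.prems(1)[of i] that
      by (simp cong: measurable_cong_sets)
    show "(\<lambda>x. ennreal ((\<beta> + (\<Sum>i\<in>I. c i * (x i - m i)))\<^sup>2)) \<in> borel_measurable (Pi\<^sub>M I M)"
      by measurable
    interpret P: prob_space "Pi\<^sub>M I M"
      using M by (intro prob_space_PiM)
    show "(\<integral>\<^sup>+ x. ennreal ((\<beta> + (\<Sum>i\<in>I. c i * (x i - m i)))\<^sup>2) \<partial>Pi\<^sub>M I M) +
        (\<integral>\<^sup>+ x. ennreal ((c k)\<^sup>2 * s k) \<partial>Pi\<^sub>M I M) =
      (\<integral>\<^sup>+ x. ennreal ((\<beta> + (\<Sum>i\<in>I. c i * (x i - m i)))\<^sup>2) \<partial>Pi\<^sub>M I M) + ennreal ((c k)\<^sup>2 * s k)"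
      by (simp add: P.emeasure_space_1)
  qed simp
  also have "\<dots> = ennreal (\<beta>\<^sup>2 + (\<Sum>i\<in>I. (c i)\<^sup>2 * s i)) + ennreal ((c k)\<^sup>2 * s k)"
    using IH by simp
  also have "\<dots> = ennreal (\<beta>\<^sup>2 + (\<Sum>i\<in>insert k I. (c i)\<^sup>2 * s i))"
    using insert.hyps s_nonneg
    by (subst ennreal_plus[symmetric]) (auto intro!: add_nonneg_nonneg sum_nonneg simp: algebra_simps)
  finally show ?case .
qed

section \<open>Two-point output laws\<close>

text \<open>The uniform pmf is pushed forward to \<open>borel\<close> because
  \<open>output_laws\<close> requires that sigma-algebra.\<close>

definition two_point :: "real \<Rightarrow> real measure" where
  "two_point b = distr (measure_pmf (pmf_of_set {- sqrt b, sqrt b})) borel (\<lambda>y. y)"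

text \<open>
  The law on \<open>{sqrt b, - sqrt b}\<close> with mean \<open>\<mu>\<close>, hence with variance \<open>b - \<mu>\<^sup>2\<close>. If
  \<open>\<mu>\<^sup>2 > b\<close>, then \<open>ennreal\<close> truncates the density and this is not a probability measure.
\<close>

definition tilted :: "real \<Rightarrow> real \<Rightarrow> real measure" where
  "tilted b \<mu> = density (two_point b) (\<lambda>y. ennreal (1 + \<mu> * y / b))"

lemma sets_two_point [simp, measurable_cong]: "sets (two_point b) = sets borel"
  by (simp add: two_point_def)

lemma space_two_point [simp]: "space (two_point b) = UNIV"
  by (simp add: two_point_def)

lemma sets_tilted [simp, measurable_cong]: "sets (tilted b \<mu>) = sets borel"
  by (simp add: tilted_def)

lemma prob_space_two_point: "prob_space (two_point b)"
  unfolding two_point_def by (intro measure_pmf.prob_space_distr) simp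

lemma AE_two_point: "AE y in two_point b. y = sqrt b \<or> y = - sqrt b"
  unfolding two_point_def by (subst AE_distr_iff) (auto simp: AE_measure_pmf_iff)

lemma integrable_two_point:
  fixes g :: "real \<Rightarrow> real"
  assumes [measurable]: "g \<in> borel_measurable borel"
  shows "integrable (two_point b) g"
  unfolding two_point_def by (subst integrable_distr_eq) (auto intro: integrable_measure_pmf_finite)

lemma integral_two_point:
  fixes g :: "real \<Rightarrow> real"
  assumes "b > 0" and [measurable]: "g \<in> borel_measurable borel"
  shows "(\<integral>y. g y \<partial>two_point b) = (g (sqrt b) + g (- sqrt b)) / 2"
proof -
  \<comment> \<open>The atoms have to be distinct for the uniform law to give each of them mass
    1/2.\<close>
  have "- sqrt b \<noteq> sqrt b"
    using assms(1) by simp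
  then show ?thesis
    unfolding two_point_def by (subst integral_distr) (auto simp: integral_pmf_of_set card_insert_if)
qed

text \<open>At the atoms the density is \<open>1 + \<mu> / sqrt b\<close> or
  \<open>1 - \<mu> / sqrt b\<close>. Its being nonnegative almost everywhere means that
  \<open>ennreal\<close> truncates nothing in the integrals against \<open>tilted\<close>.\<close>

lemma AE_tilted_density_nonneg:
  assumes "b > 0" "\<mu>\<^sup>2 \<le> b"
  shows "AE y in two_point b. 0 \<le> 1 + \<mu> * y / b"
proof -
  have "\<bar>\<mu>\<bar> \<le> sqrt b"
    using assms(2) real_le_rsqrt[of "\<bar>\<mu>\<bar>"] by simp
  then have "\<bar>\<mu>\<bar> * sqrt b \<le> sqrt b * sqrt b"
    using assms(1) by (intro mult_right_mono) auto
  then have "\<bar>\<mu> * sqrt b\<bar> \<le> b"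
    using assms(1) by (simp add: abs_mult)
  then have "- 1 \<le> \<mu> * sqrt b / b" "\<mu> * sqrt b / b \<le> 1"
    using assms(1) by (auto simp: field_simps)
  then have "0 \<le> 1 + \<mu> * y / b" if "y = sqrt b \<or> y = - sqrt b" for y
    using that by auto
  then show ?thesis
    by (rule eventually_mono[OF AE_two_point])
qed

lemma
  fixes g :: "real \<Rightarrow> real"
  assumes "b > 0" "\<mu>\<^sup>2 \<le> b" and [measurable]: "g \<in> borel_measurable borel"
  shows integrable_tilted: "integrable (tilted b \<mu>) g"
    and integral_tilted: "(\<integral>y. g y \<partial>tilted b \<mu>) =
      ((1 + \<mu> / sqrt b) * g (sqrt b) + (1 - \<mu> / sqrt b) * g (- sqrt b)) / 2"
proof -
  show "integrable (tilted b \<mu>) g"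
    unfolding tilted_def using AE_tilted_density_nonneg[OF assms(1,2)]
    by (subst integrable_density) (auto intro!: integrable_two_point)
  have "sqrt b / b = 1 / sqrt b"
    using assms(1) by (simp add: real_div_sqrt field_simps)
  then have "\<mu> * sqrt b / b = \<mu> / sqrt b"
    by (metis mult.right_neutral times_divide_eq_right)
  then show "(\<integral>y. g y \<partial>tilted b \<mu>) =
      ((1 + \<mu> / sqrt b) * g (sqrt b) + (1 - \<mu> / sqrt b) * g (- sqrt b)) / 2"
    unfolding tilted_def using AE_tilted_density_nonneg[OF assms(1,2)] assms(1)
    by (subst integral_density) (auto simp: integral_two_point)
qed

lemma prob_space_tilted:
  assumes "b > 0" "\<mu>\<^sup>2 \<le> b"
  shows "prob_space (tilted b \<mu>)"
proof
  have [measurable]: "(\<lambda>y. 1 + \<mu> * y / b) \<in> borel_measurable (two_point b)"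
    by measurable
  have "emeasure (tilted b \<mu>) (space (tilted b \<mu>)) = (\<integral>\<^sup>+ y. ennreal (1 + \<mu> * y / b) \<partial>two_point b)"
    unfolding tilted_def by (subst emeasure_density) (auto intro!: nn_integral_cong)
  also have "\<dots> = ennreal (\<integral>y. 1 + \<mu> * y / b \<partial>two_point b)"
    using AE_tilted_density_nonneg[OF assms]
    by (intro nn_integral_eq_integral integrable_two_point) auto
  also have "\<dots> = 1"
    using assms(1) by (simp add: integral_two_point)
  finally show "emeasure (tilted b \<mu>) (space (tilted b \<mu>)) = 1" .
qed

lemma tilted_in_output_laws:
  assumes "b > 0" "\<And>j. (m j)\<^sup>2 \<le> b"
  shows "(\<lambda>j. tilted b (m j)) \<in> output_laws n m (\<lambda>j. b - (m j)\<^sup>2)"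
proof -
  have mean: "(\<integral>y. y \<partial>tilted b (m j)) = m j" for j
    using assms by (simp add: integral_tilted field_simps)
  have "(\<integral>y. (y - m j)\<^sup>2 \<partial>tilted b (m j)) = b - (m j)\<^sup>2" for j
    using assms by (simp add: integral_tilted power2_eq_square field_simps)
  then show ?thesis
    using assms by (auto simp: output_laws_def mean prob_space_tilted integrable_tilted)
qed

section \<open>Two-hypothesis lower bound for an arbitrary estimator\<close>

text \<open>
  The term \<open>r\<^sup>2 * c\<close> is added to both losses so that the bound is linear in \<open>g\<close> and \<open>g'\<close> and can
  be integrated: the best loss without it is \<open>4 * r\<^sup>2 * c / (g + g')\<close>, and \<open>4 / s \<ge> 4 - s\<close>.
\<close>

lemma two_point_square_bound:
  fixes g g' t r c :: real
  assumes "g \<ge> 0" "g' \<ge> 0" "g * g' = c"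
  shows "4 * (r\<^sup>2 * c) \<le> g * ((t - r)\<^sup>2 + r\<^sup>2 * c) + g' * ((t + r)\<^sup>2 + r\<^sup>2 * c)"
proof (cases "g + g' = 0")
  case True
  then have "g = 0" "g' = 0"
    using assms by auto
  then show ?thesis
    using assms(3) by simp
next
  case False
  define s where "s = g + g'"
  have "s > 0"
    using False assms by (simp add: s_def)
  have "c \<ge> 0"
    using assms by auto
  \<comment> \<open>Multiplication by \<open>s\<close> clears the denominator of the optimal guess
    \<open>t = (g - g') * r / s\<close>. The first square measures the distance from that
    guess.\<close>
  have "s * (g * ((t - r)\<^sup>2 + r\<^sup>2 * c) + g' * ((t + r)\<^sup>2 + r\<^sup>2 * c)) - s * (4 * (r\<^sup>2 * c)) =
        (s * t - (g - g') * r)\<^sup>2 + r\<^sup>2 * c * (s - 2)\<^sup>2"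
    unfolding assms(3)[symmetric] s_def by (simp add: power2_eq_square algebra_simps)
  also have "\<dots> \<ge> 0"
    using \<open>c \<ge> 0\<close> by simp
  finally have "s * (4 * (r\<^sup>2 * c)) \<le> s * (g * ((t - r)\<^sup>2 + r\<^sup>2 * c) + g' * ((t + r)\<^sup>2 + r\<^sup>2 * c))"
    by simp
  then show ?thesis
    using \<open>s > 0\<close> by simp
qed

text \<open>Both atoms satisfy \<open>y\<^sup>2 = b\<close>, so the two likelihood ratios multiply
  to the constant \<open>c\<close>, and \<open>two_point_square_bound\<close> can be summed over the
  coordinates. The signs \<open>- m j\<close> and \<open>- - w i\<close> are left unsimplified to
  make both summands instances of one pattern.\<close>

lemma AE_two_point_product_bound:
  fixes est :: "(nat \<Rightarrow> real) \<Rightarrow> nat \<Rightarrow> real" and w m :: "nat \<Rightarrow> real" and n p :: nat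
  assumes "b > 0" "\<And>j. (m j)\<^sup>2 \<le> b"
  defines "c \<equiv> \<Prod>j<n. 1 - (m j)\<^sup>2 / b"
  defines "K \<equiv> (\<Sum>i<p. (w i)\<^sup>2) * c"
  shows "AE y in Pi\<^sub>M {..<n} (\<lambda>_. two_point b).
     ennreal (4 * K) \<le>
       (\<Prod>j<n. ennreal (1 + m j * y j / b)) * (ennreal (\<Sum>i<p. (est y i - w i)\<^sup>2) + ennreal K) +
       (\<Prod>j<n. ennreal (1 + - m j * y j / b)) * (ennreal (\<Sum>i<p. (est y i - - w i)\<^sup>2) + ennreal K)"
proof -
  have "c \<ge> 0"
    using assms(1,2) unfolding c_def by (intro prod_nonneg) (simp add: field_simps)
  then have "K \<ge> 0"
    unfolding K_def by (intro mult_nonneg_nonneg sum_nonneg) auto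
  have "AE y in Pi\<^sub>M {..<n} (\<lambda>_. two_point b). \<forall>j\<in>{..<n}.
      (y j = sqrt b \<or> y j = - sqrt b) \<and> 0 \<le> 1 + m j * y j / b \<and> 0 \<le> 1 + - m j * y j / b"
  proof (rule AE_finite_allI)
    fix j assume "j \<in> {..<n}"
    have "AE y in two_point b.
        (y = sqrt b \<or> y = - sqrt b) \<and> 0 \<le> 1 + m j * y / b \<and> 0 \<le> 1 + - m j * y / b"
      using AE_two_point[of b] AE_tilted_density_nonneg[OF assms(1), of "m j"]
        AE_tilted_density_nonneg[OF assms(1), of "- m j"] assms(2)[of j]
      by simp
    with \<open>j \<in> {..<n}\<close> show "AE y in Pi\<^sub>M {..<n} (\<lambda>_. two_point b).
      (y j = sqrt b \<or> y j = - sqrt b) \<and> 0 \<le> 1 + m j * y j / b \<and> 0 \<le> 1 + - m j * y j / b"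
      by (intro AE_PiM_component prob_space_two_point)
  qed simp
  then show ?thesis
  proof eventually_elim
    case (elim y)
    define g where "g = (\<Prod>j<n. 1 + m j * y j / b)"
    define g' where "g' = (\<Prod>j<n. 1 + - m j * y j / b)"
    have nonneg: "g \<ge> 0" "g' \<ge> 0"
      unfolding g_def g'_def using elim by (auto intro!: prod_nonneg)
    have "g * g' = c"
      unfolding g_def g'_def c_def prod.distrib[symmetric]
    proof (rule prod.cong)
      fix j assume "j \<in> {..<n}"
      with elim have "y j = sqrt b \<or> y j = - sqrt b"
        by blast
      then have "(y j)\<^sup>2 = b"
        using assms(1) by auto
      then show "(1 + m j * y j / b) * (1 + - m j * y j / b) = 1 - (m j)\<^sup>2 / b"
        using assms(1) by (simp add: power2_eq_square field_simps)
    qed simp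
    have "4 * K = (\<Sum>i<p. 4 * ((w i)\<^sup>2 * c))"
      by (simp add: K_def sum_distrib_left sum_distrib_right mult_ac)
    also have "\<dots> \<le> (\<Sum>i<p. g * ((est y i - w i)\<^sup>2 + (w i)\<^sup>2 * c) + g' * ((est y i + w i)\<^sup>2 + (w i)\<^sup>2 * c))"
      by (intro sum_mono two_point_square_bound nonneg \<open>g * g' = c\<close>)
    also have "\<dots> = g * ((\<Sum>i<p. (est y i - w i)\<^sup>2) + K) + g' * ((\<Sum>i<p. (est y i - - w i)\<^sup>2) + K)"
      by (simp add: K_def sum.distrib sum_distrib_left sum_distrib_right algebra_simps)
    finally have "ennreal (4 * K) \<le>
      ennreal (g * ((\<Sum>i<p. (est y i - w i)\<^sup>2) + K) + g' * ((\<Sum>i<p. (est y i - - w i)\<^sup>2) + K))"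
      by (rule ennreal_leI)
    also have "\<dots> = ennreal g * (ennreal (\<Sum>i<p. (est y i - w i)\<^sup>2) + ennreal K) +
        ennreal g' * (ennreal (\<Sum>i<p. (est y i - - w i)\<^sup>2) + ennreal K)"
      using nonneg \<open>K \<ge> 0\<close>
      by (simp add: ennreal_plus[symmetric] ennreal_mult[symmetric] sum_nonneg del: ennreal_plus)
    also have "ennreal g = (\<Prod>j<n. ennreal (1 + m j * y j / b))"
      unfolding g_def using elim by (subst prod_ennreal) auto
    also have "ennreal g' = (\<Prod>j<n. ennreal (1 + - m j * y j / b))"
      unfolding g'_def using elim by (subst prod_ennreal) auto
    finally show ?case .
  qed
qed

lemma PiM_tilted:
  fixes m :: "nat \<Rightarrow> real"
  assumes "b > 0" "\<And>j. (m j)\<^sup>2 \<le> b"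
  shows "Pi\<^sub>M {..<n} (\<lambda>j. tilted b (m j)) =
     density (Pi\<^sub>M {..<n} (\<lambda>_. two_point b)) (\<lambda>y. \<Prod>j<n. ennreal (1 + m j * y j / b))"
  unfolding tilted_def
  by (intro PiM_density finite_lessThan prob_space_two_point prob_space_tilted[OF assms, unfolded tilted_def]) simp_all

text \<open>Both risks are rewritten as integrals against the common law \<open>U\<close> and added.
  The pointwise bound then integrates to \<open>4 * K \<le> 2 * (R + K)\<close>, where
  \<open>K\<close> is the left-hand side of the claim.\<close>

lemma two_hypotheses_bound:
  fixes R :: ennreal and w m :: "nat \<Rightarrow> real"
  assumes b: "b > 0" and m: "\<And>j. (m j)\<^sup>2 \<le> b" and est: "est \<in> estimators n p"
    and plus: "(\<integral>\<^sup>+ y. ennreal (\<Sum>i<p. (est y i - w i)\<^sup>2) \<partial>Pi\<^sub>M {..<n} (\<lambda>j. tilted b (m j))) \<le> R"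
    and minus: "(\<integral>\<^sup>+ y. ennreal (\<Sum>i<p. (est y i - - w i)\<^sup>2) \<partial>Pi\<^sub>M {..<n} (\<lambda>j. tilted b (- m j))) \<le> R"
  shows "ennreal ((\<Sum>i<p. (w i)\<^sup>2) * (\<Prod>j<n. 1 - (m j)\<^sup>2 / b)) \<le> R" (is "ennreal ?K \<le> R")
proof -
  define U where "U = Pi\<^sub>M {..<n} (\<lambda>_. two_point b)"
  have sets_U: "sets U = sets (Pi\<^sub>M {..<n} (\<lambda>_. borel))"
    unfolding U_def by (intro sets_PiM_cong) auto
  have est_i [measurable]: "(\<lambda>y. est y i) \<in> borel_measurable U" if "i < p" for i
    using measurable_compose[OF _ measurable_component_singleton[of i "{..<p}" "\<lambda>_. borel"]] est that
    unfolding estimators_def by (subst measurable_cong_sets[OF sets_U refl]) auto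
  have obs [measurable]: "(\<lambda>y. y j) \<in> borel_measurable U" if "j < n" for j
    using that by (subst measurable_cong_sets[OF sets_U refl]) measurable
  interpret U: prob_space U
    unfolding U_def by (intro prob_space_PiM prob_space_two_point)
  \<comment> \<open>Change of measure: the likelihood ratio turns \<open>U\<close> back into the
    tilted product law. As this is a probability measure, the extra constant in the loss contributes
    exactly itself.\<close>
  have bound: "(\<integral>\<^sup>+ y. (\<Prod>j<n. ennreal (1 + s j * y j / b)) *
          (ennreal (\<Sum>i<p. (est y i - v i)\<^sup>2) + ennreal ?K) \<partial>U) \<le> R + ennreal ?K"
    if risk: "(\<integral>\<^sup>+ y. ennreal (\<Sum>i<p. (est y i - v i)\<^sup>2) \<partial>Pi\<^sub>M {..<n} (\<lambda>j. tilted b (s j))) \<le> R"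
      and s: "\<And>j. (s j)\<^sup>2 \<le> b" for s v :: "nat \<Rightarrow> real"
  proof -
    interpret P: prob_space "Pi\<^sub>M {..<n} (\<lambda>j. tilted b (s j))"
      using b s by (intro prob_space_PiM prob_space_tilted)
    have [measurable_cong]: "sets (Pi\<^sub>M {..<n} (\<lambda>j. tilted b (s j))) = sets U"
      by (simp add: PiM_tilted[OF b s] U_def)
    have "(\<integral>\<^sup>+ y. (\<Prod>j<n. ennreal (1 + s j * y j / b)) *
          (ennreal (\<Sum>i<p. (est y i - v i)\<^sup>2) + ennreal ?K) \<partial>U) =
        (\<integral>\<^sup>+ y. ennreal (\<Sum>i<p. (est y i - v i)\<^sup>2) + ennreal ?K \<partial>Pi\<^sub>M {..<n} (\<lambda>j. tilted b (s j)))"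
      unfolding PiM_tilted[OF b s] U_def[symmetric]
      by (rule nn_integral_density[symmetric]) measurable
    also have "\<dots> = (\<integral>\<^sup>+ y. ennreal (\<Sum>i<p. (est y i - v i)\<^sup>2) \<partial>Pi\<^sub>M {..<n} (\<lambda>j. tilted b (s j)))
        + (\<integral>\<^sup>+ y. ennreal ?K \<partial>Pi\<^sub>M {..<n} (\<lambda>j. tilted b (s j)))"
      by (rule nn_integral_add) measurable
    also have "\<dots> \<le> R + ennreal ?K"
      using risk by (simp add: P.emeasure_space_1 add_right_mono)
    finally show ?thesis .
  qed
  have "ennreal (4 * ?K) = (\<integral>\<^sup>+ y. ennreal (4 * ?K) \<partial>U)"
    by (simp add: U.emeasure_space_1)
  also have "\<dots> \<le> (\<integral>\<^sup>+ y.
       (\<Prod>j<n. ennreal (1 + m j * y j / b)) * (ennreal (\<Sum>i<p. (est y i - w i)\<^sup>2) + ennreal ?K) +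
       (\<Prod>j<n. ennreal (1 + - m j * y j / b)) * (ennreal (\<Sum>i<p. (est y i - - w i)\<^sup>2) + ennreal ?K) \<partial>U)"
    unfolding U_def by (intro nn_integral_mono_AE AE_two_point_product_bound b m)
  also have "\<dots> = (\<integral>\<^sup>+ y.
       (\<Prod>j<n. ennreal (1 + m j * y j / b)) * (ennreal (\<Sum>i<p. (est y i - w i)\<^sup>2) + ennreal ?K) \<partial>U) +
       (\<integral>\<^sup>+ y. (\<Prod>j<n. ennreal (1 + - m j * y j / b)) * (ennreal (\<Sum>i<p. (est y i - - w i)\<^sup>2) + ennreal ?K) \<partial>U)"
    by (rule nn_integral_add) measurable
  also have "\<dots> \<le> (R + ennreal ?K) + (R + ennreal ?K)"
    using m by (intro add_mono bound plus minus) auto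
  finally have *: "ennreal (4 * ?K) \<le> (R + ennreal ?K) + (R + ennreal ?K)" .
  have "?K \<ge> 0"
    using b m by (intro mult_nonneg_nonneg sum_nonneg prod_nonneg) (auto simp: field_simps)
  show ?thesis
  \<comment> \<open>Cancelling the added constants is a subtraction, so it is carried out in the
    reals after infinite \<open>R\<close> is split off.\<close>
  proof (cases R)
    case (real r)
    have "ennreal (4 * ?K) \<le> ennreal (2 * r + 2 * ?K)"
      using * \<open>?K \<ge> 0\<close> real
      by (simp add: ennreal_plus[symmetric] algebra_simps del: ennreal_plus)
    then have "?K \<le> r"
      using \<open>?K \<ge> 0\<close> real(1) by (subst (asm) ennreal_le_iff) auto
    then show ?thesis
      using real by (simp add: ennreal_leI)
  qed simp
qed

section \<open>Minimax lower bounds\<close>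

lemma minimax_risk_ge:
  assumes n: "n \<ge> 1" and a: "a > 0" and b: "b > 0"
    and w: "\<And>v. \<bar>\<Sum>i<p. w i * v i\<bar> \<le> lq_norm q p v"
  shows "ennreal (5 / 32 * (3 * a * b / real n) powr (2/3) * (\<Sum>i<p. (w i)\<^sup>2)) \<le> minimax_risk q p n a b x0"
proof -
  \<comment> \<open>\<open>A\<close> keeps the likelihood product away from zero, and
    \<open>\<theta>\<close> is then forced by \<open>\<theta> ^ 3 = a * A\<^sup>2\<close>. The
    constant 5/32 is 5/8 times the factor 1/4 from \<open>\<theta>\<^sup>2\<close>.\<close>
  define \<theta> where "\<theta> = (3 * a * b / real n) powr (1/3) / 2"
  define A where "A = sqrt (3 * b / (8 * real n))"
  have pos: "3 * a * b / real n > 0" "\<theta> > 0" "A > 0"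
    using a b n by (auto simp: \<theta>_def A_def)
  have \<theta>2: "\<theta>\<^sup>2 = (3 * a * b / real n) powr (2/3) / 4"
    using a b n by (simp add: \<theta>_def power_divide powr_power)
  have "\<theta> ^ 3 = 3 * a * b / real n / 8"
    using a b n by (simp add: \<theta>_def power_divide powr_power)
  moreover have A2: "A\<^sup>2 = 3 * b / (8 * real n)"
    using b by (simp add: A_def)
  ultimately have scale: "\<theta> ^ 3 = a * A\<^sup>2"
    by (simp add: field_simps)
  define f where "f = sin_ridge p w x0 A \<theta>"
  have neg: "sin_ridge p w x0 A (- \<theta>) x = - f x" for x
    by (simp add: f_def sin_ridge_def)
  have f_sq: "(f x)\<^sup>2 \<le> A\<^sup>2" for x
  proof -
    have "(f x)\<^sup>2 = A\<^sup>2 * (sin (\<theta> / A * (\<Sum>i<p. w i * (x i - x0 i))))\<^sup>2"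
      by (simp add: f_def sin_ridge_def power_mult_distrib)
    also have "\<dots> \<le> A\<^sup>2 * 1"
      by (intro mult_left_mono) (auto simp: abs_square_le_1)
    finally show ?thesis by simp
  qed
  have "A\<^sup>2 \<le> b"
    using b n by (simp add: A2 field_simps)
  with f_sq have f_le: "(f x)\<^sup>2 \<le> b" for x
    using order_trans by blast
  show ?thesis
    unfolding minimax_risk_def
  proof (intro INF_greatest)
    fix X est assume "X \<in> designs n p" and est: "est \<in> estimators n p"
    define R where "R = worst_case_risk q p n a b x0 X est"
    define m where "m = (\<lambda>j. f (X j))"
    \<comment> \<open>One variance function serves both hypotheses, because opposite means have
      equal squares.\<close>
    have v: "(\<lambda>x. b - (f x)\<^sup>2) \<in> var_class p b"
      using f_le by (simp add: var_class_def)
    have risk: "(\<integral>\<^sup>+ y. ennreal (\<Sum>i<p. (est y i - s * w i)\<^sup>2) \<partial>Pi\<^sub>M {..<n} (\<lambda>j. tilted b (sin_ridge p w x0 A s (X j)))) \<le> R"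
      if "s = \<theta> \<or> s = - \<theta>" for s
    proof -
      have sq: "(sin_ridge p w x0 A s x)\<^sup>2 = (f x)\<^sup>2" for x
        using that by (auto simp: neg) (simp add: f_def)
      have "sin_ridge p w x0 A s \<in> mean_class q p a x0"
        using that pos scale by (intro sin_ridge_in_mean_class w) auto
      moreover have "(\<lambda>j. tilted b (sin_ridge p w x0 A s (X j)))
          \<in> output_laws n (\<lambda>j. sin_ridge p w x0 A s (X j)) (\<lambda>j. b - (f (X j))\<^sup>2)"
        using tilted_in_output_laws[OF b, of "\<lambda>j. sin_ridge p w x0 A s (X j)"] f_le by (simp add: sq)
      ultimately have "(\<integral>\<^sup>+ y. ennreal (\<Sum>i<p. (est y i - grad (sin_ridge p w x0 A s) x0 i)\<^sup>2)
          \<partial>Pi\<^sub>M {..<n} (\<lambda>j. tilted b (sin_ridge p w x0 A s (X j)))) \<le> R"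
        unfolding R_def worst_case_risk_def
        by (intro SUP_upper2[of "sin_ridge p w x0 A s"] SUP_upper2[OF v] SUP_upper)
      then show ?thesis
        using pos(3) by (simp add: grad_sin_ridge)
    qed
    \<comment> \<open>Each factor loses at most \<open>A\<^sup>2 / b = 3 / (8 * n)\<close>, in total
      3/8 over \<open>n\<close> outputs; Bernoulli's inequality passes from this sum to the
      product.\<close>
    have "5 / 8 \<le> 1 - real n * (3 / (8 * real n))"
      using n by simp
    also have "\<dots> \<le> (1 - 3 / (8 * real n)) ^ n"
      using Bernoulli_inequality[of "- 3 / (8 * real n)" n] n by (simp add: field_simps)
    also have "\<dots> = (\<Prod>j<n. 1 - 3 / (8 * real n))"
      by simp
    also have "\<dots> \<le> (\<Prod>j<n. 1 - (m j)\<^sup>2 / b)"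
    proof (intro prod_mono conjI)
      fix j
      show "0 \<le> 1 - 3 / (8 * real n)"
        using n by (simp add: field_simps)
      have "(m j)\<^sup>2 / b \<le> 3 * b / (8 * real n) / b"
        using f_sq b unfolding m_def A2 by (intro divide_right_mono) auto
      then show "1 - 3 / (8 * real n) \<le> 1 - (m j)\<^sup>2 / b"
        using b by simp
    qed
    finally have prod: "5 / 8 \<le> (\<Prod>j<n. 1 - (m j)\<^sup>2 / b)" .
    have "5 / 32 * (3 * a * b / real n) powr (2/3) * (\<Sum>i<p. (w i)\<^sup>2) =
        (\<Sum>i<p. (\<theta> * w i)\<^sup>2) * (5 / 8)"
      by (simp add: power_mult_distrib \<theta>2 sum_distrib_left sum_distrib_right mult_ac)
    also have "\<dots> \<le> (\<Sum>i<p. (\<theta> * w i)\<^sup>2) * (\<Prod>j<n. 1 - (m j)\<^sup>2 / b)"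
      using prod by (intro mult_left_mono sum_nonneg) auto
    finally have "ennreal (5 / 32 * (3 * a * b / real n) powr (2/3) * (\<Sum>i<p. (w i)\<^sup>2)) \<le>
        ennreal ((\<Sum>i<p. (\<theta> * w i)\<^sup>2) * (\<Prod>j<n. 1 - (m j)\<^sup>2 / b))"
      by (rule ennreal_leI)
    also have "\<dots> \<le> R"
    proof (rule two_hypotheses_bound[OF b _ est])
      show "(m j)\<^sup>2 \<le> b" for j
        using f_le by (simp add: m_def)
    qed (use risk[of \<theta>] risk[of "- \<theta>"] in \<open>simp_all add: m_def neg flip: f_def\<close>)
    finally show "ennreal (5 / 32 * (3 * a * b / real n) powr (2/3) * (\<Sum>i<p. (w i)\<^sup>2)) \<le>
        worst_case_risk q p n a b x0 X est"
      by (simp add: R_def)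
  qed
qed

text \<open>The all-ones vector has dual norm 1 and squared Euclidean norm \<open>p\<close>, which
  is the 2/3 power of \<open>p powr (3/2)\<close>. The stated constant is below 5/32 because
  \<open>exp (- 2/3)\<close> is at most 1.\<close>

lemma minimax_risk_ge_l1:
  assumes "p \<ge> 2" "n \<ge> 1" "a > 0" "b > 0"
  shows "ennreal (1/16 * exp (- 2/3) * (3 * a * b * real p powr (3/2) / real n) powr (2/3))
           \<le> minimax_risk 1 p n a b x0"
proof -
  have "(3 * a * b * real p powr (3/2) / real n) = (3 * a * b / real n) * real p powr (3/2)"
    by simp
  then have "(3 * a * b * real p powr (3/2) / real n) powr (2/3) =
      (3 * a * b / real n) powr (2/3) * (real p powr (3/2)) powr (2/3)"
    using assms by (metis powr_mult)
  also have "(real p powr (3/2)) powr (2/3) = real p"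
    using assms(1) by (simp add: powr_powr)
  finally have eq: "(3 * a * b * real p powr (3/2) / real n) powr (2/3) =
      (3 * a * b / real n) powr (2/3) * real p" .
  have "exp (- 2/3) \<le> (1 :: real)"
    by simp
  then have "1/16 * exp (- 2/3) \<le> (5 / 32 :: real)"
    by linarith
  then have "1/16 * exp (- 2/3) * ((3 * a * b / real n) powr (2/3) * real p) \<le>
      5 / 32 * ((3 * a * b / real n) powr (2/3) * real p)"
    by (intro mult_right_mono) auto
  then have "ennreal (1/16 * exp (- 2/3) * (3 * a * b * real p powr (3/2) / real n) powr (2/3)) \<le>
      ennreal (5 / 32 * (3 * a * b / real n) powr (2/3) * (\<Sum>i<p. (1 :: real)\<^sup>2))"
    unfolding eq by (intro ennreal_leI) (simp add: mult.assoc)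
  also have "\<dots> \<le> minimax_risk 1 p n a b x0"
    using assms by (intro minimax_risk_ge) (auto simp: lq_norm_1)
  finally show ?thesis .
qed

lemma minimax_risk_ge_l2_linf:
  assumes "p \<ge> 2" "n \<ge> 1" "a > 0" "b > 0" "q \<in> {2, \<infinity>}"
  shows "ennreal (1/16 * exp (- 2/3) * (3 * a * b / real n) powr (2/3)) \<le> minimax_risk q p n a b x0"
proof -
  let ?w = "\<lambda>i. if i = 0 then 1 else 0 :: real"
  have pick: "(\<Sum>i<p. ?w i * v i) = v 0" "(\<Sum>i<p. (?w i)\<^sup>2) = 1" for v
    using assms(1) by (simp_all add: if_distrib[of "\<lambda>x. x * _"] if_distrib[of "\<lambda>x. x\<^sup>2"] cong: if_cong)
  have "exp (- 2/3) \<le> (1 :: real)"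
    by simp
  then have "1/16 * exp (- 2/3) \<le> (5 / 32 :: real)"
    by linarith
  then have "1/16 * exp (- 2/3) * (3 * a * b / real n) powr (2/3) \<le>
      5 / 32 * (3 * a * b / real n) powr (2/3)"
    by (intro mult_right_mono) auto
  then have "ennreal (1/16 * exp (- 2/3) * (3 * a * b / real n) powr (2/3)) \<le>
      ennreal (5 / 32 * (3 * a * b / real n) powr (2/3) * (\<Sum>i<p. (?w i)\<^sup>2))"
    unfolding pick by (intro ennreal_leI) simp
  also have "\<dots> \<le> minimax_risk q p n a b x0"
    using assms abs_coord_le_lq_norm[of q p] by (intro minimax_risk_ge) (auto simp only: pick)
  finally show ?thesis .
qed

section \<open>Bias and variance of central finite differences\<close>

lemma sum_paired_differences:
  fixes g :: "nat \<Rightarrow> real"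
  shows "(\<Sum>j<N. g (2 * j) - g (2 * j + 1)) = (\<Sum>l<2 * N. (- 1) ^ l * g l)"
  by (induction N) simp_all

text \<open>The indices with quotient \<open>i\<close> form the block of length \<open>m\<close>
  starting at \<open>i * m\<close>. Thus a sum over one block becomes a sum over all outputs with
  zero weights elsewhere.\<close>

lemma sum_block:
  fixes h :: "nat \<Rightarrow> real"
  assumes "i < p"
  shows "(\<Sum>k<p * m. if k div m = i then h k else 0) = (\<Sum>l<m. h (i * m + l))"
proof (cases "m = 0")
  case False
  have block: "k div m = i \<longleftrightarrow> k \<in> {i * m..<m + i * m}" for k
  proof -
    have "k div m = i \<longleftrightarrow> i \<le> k div m \<and> k div m < Suc i"
      by auto
    then show ?thesis
      using False by (simp add: less_eq_div_iff_mult_less_eq div_less_iff_less_mult)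
  qed
  have "Suc i * m \<le> p * m"
    using assms by (intro mult_le_mono1) simp
  then have "{k \<in> {..<p * m}. k div m = i} = {i * m..<m + i * m}"
    unfolding block by auto
  then have "(\<Sum>k<p * m. if k div m = i then h k else 0) = sum h {i * m..<m + i * m}"
    by (simp add: sum.If_cases Int_def)
  also have "\<dots> = (\<Sum>l<m. h (i * m + l))"
    using sum.shift_bounds_nat_ivl[of h 0 "i * m" m] by (simp add: atLeast0LessThan add.commute)
  finally show ?thesis .
qed simp

lemma cfd_bias:
  assumes f: "f \<in> mean_class q p a x0" and q: "q \<in> {1, 2, \<infinity>}" and i: "i < p"
    and x0: "x0 \<in> Rn p" and \<delta>: "\<delta> > 0"
  shows "\<bar>(f (x0(i := x0 i + \<delta>)) - f (x0(i := x0 i - \<delta>))) / (2 * \<delta>) - grad f x0 i\<bar> \<le> a * \<delta>\<^sup>2 / 6"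
proof -
  have expand: "\<bar>f (x0(i := x0 i + s)) - f x0 - grad f x0 i * s - 1/2 * (s * hessian f x0 i i * s)\<bar>
      \<le> a / 6 * \<bar>s\<bar> ^ 3" for s
  proof -
    let ?x = "x0(i := x0 i + s)"
    have "?x \<in> Rn p"
      using x0 i by (auto simp: Rn_def PiE_iff extensional_def)
    then have bound: "\<bar>f ?x - f x0 - (\<Sum>j<p. grad f x0 j * (?x j - x0 j))
             - 1/2 * (\<Sum>j<p. \<Sum>k<p. (?x j - x0 j) * hessian f x0 j k * (?x k - x0 k))\<bar>
           \<le> a / 6 * lq_norm q p (\<lambda>j. ?x j - x0 j) ^ 3"
      using f unfolding mean_class_def by blast
    have diff: "?x j - x0 j = (if j = i then s else 0)" for j
      by simp
    have "(\<Sum>j<p. grad f x0 j * (?x j - x0 j)) = grad f x0 i * s"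
      using i unfolding diff by (simp add: if_distrib[of "\<lambda>z. _ * z"] cong: if_cong)
    moreover have "(\<Sum>j<p. \<Sum>k<p. (?x j - x0 j) * hessian f x0 j k * (?x k - x0 k)) =
        s * hessian f x0 i i * s"
    proof -
      have "(\<Sum>k<p. (?x j - x0 j) * hessian f x0 j k * (?x k - x0 k)) =
          (if j = i then s * hessian f x0 i i * s else 0)" for j
        using i unfolding diff by (simp add: if_distrib[of "\<lambda>z. _ * z"] cong: if_cong)
      then show ?thesis
        using i by simp
    qed
    ultimately show ?thesis
      using bound lq_norm_single[OF q i, of x0 s] by simp
  qed
  let ?d = "f (x0(i := x0 i + \<delta>)) - f (x0(i := x0 i - \<delta>)) - 2 * \<delta> * grad f x0 i"
  \<comment> \<open>\<open>?q\<close> collects the even terms of the expansion, which agree at both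
    points. Subtracting the two remainders therefore leaves \<open>?d\<close>.\<close>
  let ?q = "f x0 + 1/2 * (\<delta> * hessian f x0 i i * \<delta>)"
  have "\<bar>(f (x0(i := x0 i + \<delta>)) - grad f x0 i * \<delta> - ?q) -
      (f (x0(i := x0 i - \<delta>)) + grad f x0 i * \<delta> - ?q)\<bar> \<le> a / 6 * \<delta> ^ 3 + a / 6 * \<delta> ^ 3"
    using expand[of \<delta>] expand[of "- \<delta>"] \<delta>
    by (intro order_trans[OF abs_triangle_ineq4 add_mono]) (simp_all add: algebra_simps)
  moreover have "(f (x0(i := x0 i + \<delta>)) - grad f x0 i * \<delta> - ?q) -
      (f (x0(i := x0 i - \<delta>)) + grad f x0 i * \<delta> - ?q) = ?d"
    by (simp add: algebra_simps)
  ultimately have "\<bar>?d\<bar> \<le> 2 * (a / 6 * \<delta> ^ 3)"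
    by (simp only: mult_2)
  then have "\<bar>?d\<bar> / (2 * \<delta>) \<le> 2 * (a / 6 * \<delta> ^ 3) / (2 * \<delta>)"
    using \<delta> by (intro divide_right_mono) auto
  also have "\<dots> = a * \<delta>\<^sup>2 / 6"
    using \<delta> by (simp add: power3_eq_cube power2_eq_square)
  also have "\<bar>?d\<bar> / (2 * \<delta>) = \<bar>?d / (2 * \<delta>)\<bar>"
    using \<delta> by (simp add: abs_divide)
  also have "?d / (2 * \<delta>) = (f (x0(i := x0 i + \<delta>)) - f (x0(i := x0 i - \<delta>))) / (2 * \<delta>) - grad f x0 i"
    using \<delta> by (simp add: field_simps)
  finally show ?thesis .
qed

text \<open>The coordinate is a linear statistic with weights \<open>c\<close>. Splitting each
  output into mean and noise leaves a deterministic bias \<open>\<beta>\<close> and a centred sum,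
  whose mean square \<open>nn_integral_PiM_affine_square\<close> gives exactly.\<close>

lemma cfd_coordinate_risk:
  fixes N :: nat
  assumes q: "q \<in> {1, 2, \<infinity>}" and i: "i < p" and N: "N \<ge> 1" and n: "n = 2 * p * N"
    and x0: "x0 \<in> Rn p" and \<delta>: "\<delta> > 0"
    and f: "f \<in> mean_class q p a x0" and v: "v \<in> var_class p b"
    and M: "M \<in> output_laws n (\<lambda>j. f (cfd_design p n x0 \<delta> j)) (\<lambda>j. v (cfd_design p n x0 \<delta> j))"
  shows "(\<integral>\<^sup>+ y. ennreal ((cfd_estimator p n \<delta> y i - grad f x0 i)\<^sup>2) \<partial>Pi\<^sub>M {..<n} M)
           \<le> ennreal ((a * \<delta>\<^sup>2 / 6)\<^sup>2 + b / (2 * real N * \<delta>\<^sup>2))"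
proof -
  define X where "X = cfd_design p n x0 \<delta>"
  define m where "m = 2 * N"
  \<comment> \<open>The factor \<open>1 / N\<close> comes from averaging and
    \<open>1 / (2 * \<delta>)\<close> from the difference quotient. In \<open>c\<close> the sign
    follows the parity of the position inside block \<open>i\<close>.\<close>
  define \<kappa> where "\<kappa> = 1 / (2 * real N * \<delta>)"
  define c where "c = (\<lambda>k. if k div m = i then \<kappa> * (- 1) ^ (k mod m) else 0)"
  have p: "p > 0" using i by simp
  have div: "n div p = m" "n div (2 * p) = N" "real n / (2 * real p) = real N" "n = p * m"
    using p by (simp_all add: n m_def)
  have sum_c: "(\<Sum>k<n. c k * g k) = \<kappa> * (\<Sum>j<N. g (i * m + 2 * j) - g (i * m + 2 * j + 1))"
    for g :: "nat \<Rightarrow> real"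
  proof -
    have "(\<Sum>k<n. c k * g k) = (\<Sum>k<p * m. if k div m = i then \<kappa> * (- 1) ^ (k mod m) * g k else 0)"
      unfolding div(4) by (intro sum.cong) (auto simp: c_def)
    also have "\<dots> = (\<Sum>l<m. \<kappa> * (- 1) ^ ((i * m + l) mod m) * g (i * m + l))"
      by (rule sum_block[OF i])
    also have "\<dots> = \<kappa> * (\<Sum>l<2 * N. (- 1) ^ l * g (i * m + l))"
      by (simp add: sum_distrib_left m_def mult.assoc)
    also have "\<dots> = \<kappa> * (\<Sum>j<N. g (i * m + 2 * j) - g (i * m + 2 * j + 1))"
      using sum_paired_differences[of "\<lambda>l. g (i * m + l)" N] by (simp add: add.assoc)
    finally show ?thesis .
  qed
  have est: "cfd_estimator p n \<delta> y i = (\<Sum>k<n. c k * y k)" for y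
    unfolding sum_c cfd_estimator_def div(1-3) using i
    by (simp add: \<kappa>_def sum_divide_distrib[symmetric])
  define \<beta> where "\<beta> = (\<Sum>k<n. c k * f (X k)) - grad f x0 i"
  have X_block: "X (i * m + 2 * j) = x0(i := x0 i + \<delta>)" "X (i * m + 2 * j + 1) = x0(i := x0 i - \<delta>)"
    if "j < N" for j
  proof -
    have l: "2 * j < m" "2 * j + 1 < m"
      using that by (auto simp: m_def)
    have d: "(i * m + l) div m = i" "(i * m + l) mod m = l" if "l < m" for l
      using that by auto
    show "X (i * m + 2 * j) = x0(i := x0 i + \<delta>)" "X (i * m + 2 * j + 1) = x0(i := x0 i - \<delta>)"
      unfolding X_def cfd_design_def div(1) Let_def add.assoc d[OF l(1)] d[OF l(2)] by simp_all
  qed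
  have "(\<Sum>k<n. c k * f (X k)) = (f (x0(i := x0 i + \<delta>)) - f (x0(i := x0 i - \<delta>))) / (2 * \<delta>)"
    using N by (simp add: sum_c X_block[simplified] \<kappa>_def)
  then have "\<bar>\<beta>\<bar> \<le> a * \<delta>\<^sup>2 / 6"
    using cfd_bias[OF f q i x0 \<delta>] by (simp add: \<beta>_def)
  then have bias: "\<beta>\<^sup>2 \<le> (a * \<delta>\<^sup>2 / 6)\<^sup>2"
    by (rule abs_le_square_iff[THEN iffD1, OF order_trans[OF _ abs_ge_self]])
  have X_Rn: "X k \<in> Rn p" if "k < n" for k
  proof -
    have "k div m < p"
      using that unfolding div(4) by (simp add: less_mult_imp_div_less)
    then show ?thesis
      using x0 by (auto simp: X_def cfd_design_def div Let_def Rn_def PiE_iff extensional_def)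
  qed
  have "(\<Sum>k<n. (c k)\<^sup>2 * v (X k)) \<le> (\<Sum>k<n. (c k)\<^sup>2 * b)"
    using v X_Rn by (intro sum_mono mult_left_mono) (auto simp: var_class_def)
  \<comment> \<open>Squaring removes the alternating signs, so all \<open>2 * N\<close> outputs of
    the block carry the same weight.\<close>
  also have "\<dots> = (\<Sum>k<p * m. if k div m = i then \<kappa>\<^sup>2 * b else 0)"
    unfolding div(4) by (intro sum.cong) (auto simp: c_def power_mult_distrib simp flip: power_mult)
  also have "\<dots> = m * (\<kappa>\<^sup>2 * b)"
    by (simp add: sum_block[OF i])
  also have "\<dots> = b / (2 * real N * \<delta>\<^sup>2)"
    using N \<delta> by (simp add: m_def \<kappa>_def power2_eq_square field_simps)
  finally have variance: "(\<Sum>k<n. (c k)\<^sup>2 * v (X k)) \<le> b / (2 * real N * \<delta>\<^sup>2)" .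
  \<comment> \<open>\<open>output_laws\<close> says nothing about \<open>M j\<close> for \<open>j \<ge> n\<close>.\<close>
  define M' where "M' = (\<lambda>j. if j < n then M j else return borel 0)"
  have M': "Pi\<^sub>M {..<n} M = Pi\<^sub>M {..<n} M'"
    by (intro PiM_cong) (auto simp: M'_def)
  have "(\<integral>\<^sup>+ y. ennreal ((cfd_estimator p n \<delta> y i - grad f x0 i)\<^sup>2) \<partial>Pi\<^sub>M {..<n} M) =
      (\<integral>\<^sup>+ y. ennreal ((\<beta> + (\<Sum>k<n. c k * (y k - f (X k))))\<^sup>2) \<partial>Pi\<^sub>M {..<n} M')"
    unfolding M' by (simp add: est \<beta>_def algebra_simps sum_subtractf)
  also have "\<dots> = ennreal (\<beta>\<^sup>2 + (\<Sum>k<n. (c k)\<^sup>2 * v (X k)))"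
  proof (rule nn_integral_PiM_affine_square)
    show "prob_space (M' j)" for j
      using M by (auto simp: M'_def output_laws_def intro: prob_space_return)
  qed (use M in \<open>auto simp: M'_def output_laws_def X_def\<close>)
  also have "\<dots> \<le> ennreal ((a * \<delta>\<^sup>2 / 6)\<^sup>2 + b / (2 * real N * \<delta>\<^sup>2))"
    using bias variance by (intro ennreal_leI add_mono)
  finally show ?thesis .
qed

lemma cfd_risk_le:
  fixes N :: nat
  assumes q: "q \<in> {1, 2, \<infinity>}" and p: "p \<ge> 1" and N: "N \<ge> 1" and n: "n = 2 * p * N"
    and x0: "x0 \<in> Rn p" and \<delta>: "\<delta> > 0" and "b > 0"
  shows "worst_case_risk q p n a b x0 (cfd_design p n x0 \<delta>) (cfd_estimator p n \<delta>)
           \<le> ennreal (real p * ((a * \<delta>\<^sup>2 / 6)\<^sup>2 + b / (2 * real N * \<delta>\<^sup>2)))"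
  unfolding worst_case_risk_def
proof (intro SUP_least)
  fix f v M assume f: "f \<in> mean_class q p a x0" and v: "v \<in> var_class p b"
    and M: "M \<in> output_laws n (\<lambda>j. f (cfd_design p n x0 \<delta> j)) (\<lambda>j. v (cfd_design p n x0 \<delta> j))"
  let ?B = "(a * \<delta>\<^sup>2 / 6)\<^sup>2 + b / (2 * real N * \<delta>\<^sup>2)"
  have "sets (Pi\<^sub>M {..<n} M) = sets (Pi\<^sub>M {..<n} (\<lambda>_. borel :: real measure))"
    using M by (intro sets_PiM_cong) (auto simp: output_laws_def)
  then have obs: "(\<lambda>y. y k) \<in> borel_measurable (Pi\<^sub>M {..<n} M)" if "k < n" for k
    using that by (subst measurable_cong_sets) auto
  \<comment> \<open>Every index read by the estimator must lie below \<open>n\<close> for the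
    projections to be measurable components of the product.\<close>
  have idx: "i * (n div p) + 2 * j + 1 < n" if "i < p" "j < n div (2 * p)" for i j
  proof -
    have "i * (n div p) + 2 * j + 1 < Suc i * (n div p)"
      using that p by (simp add: n)
    also have "\<dots> \<le> p * (n div p)"
      using that by (intro mult_le_mono1) simp
    finally show ?thesis
      using p by (simp add: n)
  qed
  have [measurable]: "(\<lambda>y. cfd_estimator p n \<delta> y i) \<in> borel_measurable (Pi\<^sub>M {..<n} M)" if "i < p" for i
  proof -
    have obs': "(\<lambda>y. y (i * (n div p) + 2 * j)) \<in> borel_measurable (Pi\<^sub>M {..<n} M)"
      "(\<lambda>y. y (i * (n div p) + 2 * j + 1)) \<in> borel_measurable (Pi\<^sub>M {..<n} M)"
      if "j < n div (2 * p)" for j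
      using idx[OF \<open>i < p\<close> that] by (auto intro!: obs)
    show ?thesis
      unfolding cfd_estimator_def restrict_apply
      by (auto simp only: that lessThan_iff if_True intro!: obs' borel_measurable_times
          borel_measurable_const borel_measurable_sum borel_measurable_divide borel_measurable_diff)
  qed
  have "(\<integral>\<^sup>+ y. ennreal (\<Sum>i<p. (cfd_estimator p n \<delta> y i - grad f x0 i)\<^sup>2) \<partial>Pi\<^sub>M {..<n} M) =
      (\<integral>\<^sup>+ y. (\<Sum>i<p. ennreal ((cfd_estimator p n \<delta> y i - grad f x0 i)\<^sup>2)) \<partial>Pi\<^sub>M {..<n} M)"
    by simp
  also have "\<dots> = (\<Sum>i<p. \<integral>\<^sup>+ y. ennreal ((cfd_estimator p n \<delta> y i - grad f x0 i)\<^sup>2) \<partial>Pi\<^sub>M {..<n} M)"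
    by (rule nn_integral_sum) measurable
  also have "\<dots> \<le> (\<Sum>i<p. ennreal ?B)"
    using q N n x0 \<delta> f v M by (intro sum_mono cfd_coordinate_risk) auto
  also have "\<dots> = ennreal (real p * ?B)"
    using \<open>b > 0\<close> by (simp add: ennreal_mult ennreal_of_nat_eq_real_of_nat)
  finally show "(\<integral>\<^sup>+ y. ennreal (\<Sum>i<p. (cfd_estimator p n \<delta> y i - grad f x0 i)\<^sup>2) \<partial>Pi\<^sub>M {..<n} M)
      \<le> ennreal (real p * ?B)" .
qed

section \<open>The chosen step and comparison with the minimax risk\<close>

text \<open>With \<open>r = \<delta>\<^sup>2\<close> and \<open>B = b * p / n\<close>, the error
  bound per coordinate is \<open>a\<^sup>2 * r\<^sup>2 / 36 + B / r\<close>. It is minimal at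
  \<open>r ^ 3 = 18 * B / a\<^sup>2\<close>, which is the given step; there the squared bias is half
  the variance term.\<close>

lemma cfd_error_at_optimal_step:
  fixes N :: nat
  assumes "p \<ge> 1" "N \<ge> 1" "a > 0" "b > 0" and n: "n = 2 * p * N"
    and \<delta>: "\<delta> = (18 * b / a\<^sup>2) powr (1/6) * (real n / real p) powr (- 1/6)"
  shows "real p * ((a * \<delta>\<^sup>2 / 6)\<^sup>2 + b / (2 * real N * \<delta>\<^sup>2)) \<le> 3 / 2 * (real p)\<^sup>2 * (3 * a * b / real n) powr (2/3)"
proof -
  define B where "B = b * real p / real n"
  have pos: "real n > 0" "real p > 0" "B > 0"
    using assms by (auto simp: B_def n)
  have np: "real n / real p > 0"
    using pos by simp
  have \<delta>_eq: "\<delta> = (18 * B / a\<^sup>2) powr (1/6)"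
  proof -
    have "(real n / real p) powr (- 1/6) = (real p / real n) powr (1/6)"
      using pos by (simp add: powr_minus_divide powr_divide)
    then have "\<delta> = (18 * b / a\<^sup>2 * (real p / real n)) powr (1/6)"
      unfolding \<delta> using assms(3,4) pos by (subst powr_mult) auto
    then show ?thesis
      by (simp add: B_def mult_ac)
  qed
  define r where "r = (18 * B / a\<^sup>2) powr (1/3)"
  have "\<delta>\<^sup>2 = r"
    using pos assms(3) by (simp add: \<delta>_eq r_def powr_power)
  have r: "r > 0"
    using pos assms(3) by (simp add: r_def)
  have r3: "r ^ 3 = 18 * B / a\<^sup>2"
    using pos assms(3) by (simp add: r_def powr_power)
  have var: "b / (2 * real N * r) = B / r"
    using assms(1,2) r by (simp add: B_def n field_simps)
  have "(a * r / 6)\<^sup>2 = a\<^sup>2 * r ^ 3 / (36 * r)"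
    using r by (simp add: power2_eq_square power3_eq_cube field_simps)
  also have "\<dots> = B / r / 2"
    using assms(3) by (simp add: r3)
  finally have "real p * ((a * \<delta>\<^sup>2 / 6)\<^sup>2 + b / (2 * real N * \<delta>\<^sup>2)) = 3 / 2 * real p * (B / r)"
    unfolding \<open>\<delta>\<^sup>2 = r\<close> var by (simp add: algebra_simps)
  \<comment> \<open>Cubing both sides removes the fractional powers. The cube of the left side
    carries only \<open>p\<close> squared, which is relaxed to \<open>p\<close> cubed to get a whole
    power of \<open>p\<close>.\<close>
  also have "B / r \<le> real p * (3 * a * b / real n) powr (2/3)"
  proof (rule power_le_imp_le_base[of _ 2])
    show "(B / r) ^ Suc 2 \<le> (real p * (3 * a * b / real n) powr (2/3)) ^ Suc 2"
    proof -
      have x: "3 * a * b / real n > 0"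
        using assms(3,4) pos by simp
      have "(B / r) ^ Suc 2 = B ^ 3 / r ^ 3"
        by (simp add: power_divide eval_nat_numeral)
      also have "\<dots> = a\<^sup>2 * B\<^sup>2 / 18"
        unfolding r3 using pos assms(3) by (simp add: power2_eq_square power3_eq_cube field_simps)
      also have "\<dots> = real p ^ 2 * (a * b / real n)\<^sup>2 / 18"
        by (simp add: B_def power2_eq_square)
      also have "\<dots> \<le> real p ^ 3 * (9 * (a * b / real n)\<^sup>2)"
      proof -
        have "real p ^ 2 \<le> real p ^ 3"
          using assms(1) by (intro power_increasing) auto
        moreover have "(a * b / real n)\<^sup>2 / 18 \<le> 9 * (a * b / real n)\<^sup>2"
          using zero_le_power2[of "a * b / real n"] by linarith
        ultimately have "real p ^ 2 * ((a * b / real n)\<^sup>2 / 18) \<le> real p ^ 3 * (9 * (a * b / real n)\<^sup>2)"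
          by (intro mult_mono) auto
        then show ?thesis by simp
      qed
      also have "9 * (a * b / real n)\<^sup>2 = (3 * a * b / real n)\<^sup>2"
        by (simp add: power2_eq_square)
      also have "\<dots> = ((3 * a * b / real n) powr (2/3)) ^ 3"
      proof -
        have "y\<^sup>2 = (y powr (2/3)) ^ 3" if "y > 0" for y :: real
          using that by (simp add: powr_power)
        then show ?thesis
          using x by blast
      qed
      finally show ?thesis
        by (simp add: power_mult_distrib eval_nat_numeral mult_ac)
    qed
  qed simp
  then have "3 / 2 * real p * (B / r) \<le> 3 / 2 * real p * (real p * (3 * a * b / real n) powr (2/3))"
    by (intro mult_left_mono) auto
  finally show ?thesis
    by (simp add: power2_eq_square mult_ac)
qed

text \<open>Dropping the dimension factor for \<open>q = 1\<close> gives one lower bound for all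
  three norms, so the comparison needs no case split.\<close>

lemma minimax_risk_ge_common:
  assumes "q \<in> {1, 2, \<infinity>}" "p \<ge> 2" "n \<ge> 1" "a > 0" "b > 0"
  shows "ennreal (1/16 * exp (- 2/3) * (3 * a * b / real n) powr (2/3)) \<le> minimax_risk q p n a b x0"
proof (cases "q = 1")
  case True
  have "3 * a * b * 1 / real n \<le> 3 * a * b * real p powr (3/2) / real n"
    using assms by (intro divide_right_mono mult_left_mono ge_one_powr_ge_zero) auto
  then have "ennreal (1/16 * exp (- 2/3) * (3 * a * b / real n) powr (2/3)) \<le>
      ennreal (1/16 * exp (- 2/3) * (3 * a * b * real p powr (3/2) / real n) powr (2/3))"
    using assms by (intro ennreal_leI mult_left_mono powr_mono2) auto
  then show ?thesis
    unfolding True by (rule order_trans[OF _ minimax_risk_ge_l1[OF assms(2-5)]])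
next
  case False
  then show ?thesis
    using assms by (intro minimax_risk_ge_l2_linf) auto
qed

text \<open>The constant is 3/2 divided by the lower-bound constant
  \<open>1/16 * exp (- 2/3)\<close>. One factor \<open>p\<close> comes from summing the coordinates,
  the other from the relaxed bound on \<open>B / r\<close>.\<close>

lemma cfd_risk_le_minimax_risk:
  assumes q: "q \<in> {1, 2, \<infinity>}" and p: "p \<ge> 2" and n: "n \<ge> 1" "2 * p dvd n"
    and a: "a > 0" and b: "b > 0" and x0: "x0 \<in> Rn p"
    and \<delta>: "\<delta> = (18 * b / a\<^sup>2) powr (1/6) * (real n / real p) powr (- 1/6)"
  shows "worst_case_risk q p n a b x0 (cfd_design p n x0 \<delta>) (cfd_estimator p n \<delta>)
           \<le> ennreal (24 * exp (2/3) * real p powr 2) * minimax_risk q p n a b x0"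
proof -
  obtain N where N: "n = 2 * p * N"
    using n(2) by auto
  then have "N \<ge> 1"
    using n(1) by (cases N) auto
  have "\<delta> > 0"
    using a b n p by (simp add: \<delta>)
  define L where "L = 1/16 * exp (- 2/3) * (3 * a * b / real n) powr (2/3)"
  have "worst_case_risk q p n a b x0 (cfd_design p n x0 \<delta>) (cfd_estimator p n \<delta>)
      \<le> ennreal (real p * ((a * \<delta>\<^sup>2 / 6)\<^sup>2 + b / (2 * real N * \<delta>\<^sup>2)))"
    using p by (intro cfd_risk_le q N \<open>N \<ge> 1\<close> x0 \<open>\<delta> > 0\<close> b) simp
  also have "\<dots> \<le> ennreal (3 / 2 * (real p)\<^sup>2 * (3 * a * b / real n) powr (2/3))"
    using p by (intro ennreal_leI cfd_error_at_optimal_step N \<open>N \<ge> 1\<close> a b \<delta>) simp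
  also have "3 / 2 * (real p)\<^sup>2 * (3 * a * b / real n) powr (2/3) = 24 * exp (2/3) * real p powr 2 * L"
    using p by (simp add: L_def exp_minus field_simps)
  also have "ennreal \<dots> = ennreal (24 * exp (2/3) * real p powr 2) * ennreal L"
    by (intro ennreal_mult) (auto simp: L_def)
  also have "\<dots> \<le> ennreal (24 * exp (2/3) * real p powr 2) * minimax_risk q p n a b x0"
    unfolding L_def by (intro mult_left_mono minimax_risk_ge_common q p n a b) simp
  finally show ?thesis .
qed

theorem theorem5:
  shows
    "(\<forall>(p::nat) (n::nat) (a::real) (b::real) x0.
        p \<ge> 2 \<and> n \<ge> 1 \<and> a > 0 \<and> b > 0 \<and> x0 \<in> Rn p \<longrightarrow>
          minimax_risk 1 p n a b x0
            \<ge> ennreal (1/16 * exp (- 2/3) * (3 * a * b * real p powr (3/2) / real n) powr (2/3)) \<and>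
          (\<forall>q\<in>{2, \<infinity>}.
             minimax_risk q p n a b x0
               \<ge> ennreal (1/16 * exp (- 2/3) * (3 * a * b / real n) powr (2/3)))) \<and>
     (\<exists>(C::real) (k::real). C > 0 \<and> k > 0 \<and>
        (\<forall>q\<in>{1, 2, \<infinity>}. \<forall>(p::nat) (n::nat) (a::real) (b::real) x0 (\<delta>::real).
           p \<ge> 2 \<and> n \<ge> 1 \<and> 2 * p dvd n \<and> a > 0 \<and> b > 0 \<and> x0 \<in> Rn p \<and>
           \<delta> = (18 * b / a\<^sup>2) powr (1/6) * (real n / real p) powr (- 1/6) \<longrightarrow>
             worst_case_risk q p n a b x0 (cfd_design p n x0 \<delta>) (cfd_estimator p n \<delta>)
               \<le> ennreal (C * real p powr k) * minimax_risk q p n a b x0))"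
proof (rule conjI)
  show "\<exists>(C::real) (k::real). C > 0 \<and> k > 0 \<and>
        (\<forall>q\<in>{1, 2, \<infinity>}. \<forall>(p::nat) (n::nat) (a::real) (b::real) x0 (\<delta>::real).
           p \<ge> 2 \<and> n \<ge> 1 \<and> 2 * p dvd n \<and> a > 0 \<and> b > 0 \<and> x0 \<in> Rn p \<and>
           \<delta> = (18 * b / a\<^sup>2) powr (1/6) * (real n / real p) powr (- 1/6) \<longrightarrow>
             worst_case_risk q p n a b x0 (cfd_design p n x0 \<delta>) (cfd_estimator p n \<delta>)
               \<le> ennreal (C * real p powr k) * minimax_risk q p n a b x0)"
    by (rule exI[of _ "24 * exp (2/3)"], rule exI[of _ 2]) (use cfd_risk_le_minimax_risk in auto)
qed (use minimax_risk_ge_l1 minimax_risk_ge_l2_linf in auto)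

end
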